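(* Let $Q$ be a quiver which is mutation-equivalent to the quiver $X_7$ (equivalently, $Q$ is, up to isomorphism, one of the two quivers $X_7$ and $X_7'$ described in the context). Then $Q$ does not have any maximal green sequences.
   Context: Quivers are finite directed multigraphs without loops and without 2-cycles. A quiver $Q$ with vertices $1,\dots,n$ is identified with the skew-symmetric integer $n\times n$ matrix $B=B^Q$ defined by: $B_{i,j}>0$ if and only if there are $B_{i,j}$ many arrows from $j$ to $i$; $B_{i,j}=0$ if $i$ and $j$ are not joined by an arrow. Notation: $[b]_+=\max(b,0)$. For $k\in\{1,\dots,n\}$, the matrix mutation $\mu_k(B)=B'$ is given by $B'_{ij}=-B_{ij}$ if $i=k$ or $j=k$, and $B'_{ij}=B_{ij}+[B_{ik}]_+[B_{kj}]_+-[-B_{ik}]_+[-B_{kj}]_+$ otherwise. It is an involution; two matrices (or the corresponding quivers) are mutation-equivalent if one is obtained from the other by a finite sequence of mutations (quivers being considered up to isomorphism, i.e. relabeling of vertices). The quiver $X_7$ has vertices $0,a_1,b_1,a_2,b_2,a_3,b_3$ and, for each $i=1,2,3$, one arrow $0\to a_i$, two arrows $a_i\to b_i$, one arrow $b_i\to 0$ (and no other arrows). The quiver $X_7'$ has vertices $0,a_1,b_1,a_2,b_2,a_3,b_3$ and the following arrows, each of multiplicity one (and no others): $a_i\to 0$, $0\to b_i$, $a_i\to b_i$ for $i=1,2,3$, and $b_i\to a_j$ for all $i\neq j$ in $\{1,2,3\}$. It is known that the mutation class of $X_7$ consists, up to isomorphism, of $X_7$ and $X_7'$. A $Y$-seed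 is a pair $(\mathbf c,B)$ with $B$ a skew-symmetric integer $n\times n$ matrix and $\mathbf c=(\mathbf c_1,\dots,\mathbf c_n)$ a tuple of non-zero vectors in $\mathbb Z^n$. Write $\mathbf c_j>0$ (resp. $\mathbf c_j<0$) if all entries of the non-zero vector $\mathbf c_j$ are non-negative (resp. non-positive), and $\operatorname{sgn}(\mathbf c_j)=1$ (resp. $-1$) accordingly. If $\mathbf c_k>0$ or $\mathbf c_k<0$, the $Y$-seed mutation $\mu_k(\mathbf c,B)=(\mathbf c',B')$ is defined by $B'=\mu_k(B)$, $\mathbf c'_k=-\mathbf c_k$, and $\mathbf c'_i=\mathbf c_i+[\operatorname{sgn}(\mathbf c_k)B_{k,i}]_+\mathbf c_k$ for $i\ne k$. The initial $Y$-seed of $B_0$ is $(\mathbf c_0,B_0)$, where $\mathbf c_0$ is the tuple of standard basis vectors of $\mathbb Z^n$. (For skew-symmetric $B_0$ it is known that in every $Y$-seed obtained from $(\mathbf c_0,B_0)$ by successive mutations every $\mathbf c_j$ satisfies $\mathbf c_j>0$ or $\mathbf c_j<0$, so mutations are always defined.) A green sequence for $B_0$ is a sequence $(i_1,\dots,i_l)$ of indices such that for every $1\le k\le l$, writing $(\mathbf c,B)=\mu_{i_{k-1}}\circ\cdots\circ\mu_{i_1}(\mathbf c_0,B_0)$ (with $(\mathbf c,B)=(\mathbf c_0,B_0)$ if $k=1$), one has $\mathbf c_{i_k}>0$. It is maximal if for $(\mathbf c,B)=\mu_{i_l}\circ\cdots\circ\mu_{i_1}(\mathbf c_0,B_0)$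 one has $\mathbf c_k<0$ for all $k=1,\dots,n$. A (maximal) green sequence for a quiver is one for its associated skew-symmetric matrix. *)

theory Defs
  imports "HOL-Analysis.Analysis"
begin

text \<open>
  A quiver on the finite vertex type \<open>'n\<close> is given by its arrow multiplicities:
  \<open>Q i j\<close> is the number of arrows from \<open>i\<close> to \<open>j\<close>.
\<close>

type_synonym 'n quiver = "'n \<Rightarrow> 'n \<Rightarrow> nat"

definition is_quiver :: "'n::finite quiver \<Rightarrow> bool" where
  "is_quiver Q \<longleftrightarrow> (\<forall>i. Q i i = 0) \<and> (\<forall>i j. Q i j = 0 \<or> Q j i = 0)"

text \<open>
  Orientation convention: a positive entry in row \<open>i\<close> and column \<open>j\<close> counts the arrows
  from \<open>j\<close> to \<open>i\<close>. As there are no 2-cycles, at most one of the two terms below is non-zero.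
\<close>

definition quiver_matrix :: "'n::finite quiver \<Rightarrow> int^'n^'n" where
  "quiver_matrix Q = (\<chi> i j. int (Q j i) - int (Q i j))"

lemma quiver_matrix_skew: "transpose (quiver_matrix Q) = - quiver_matrix Q"
  by (simp add: quiver_matrix_def transpose_def vec_eq_iff)

lemma quiver_matrix_pos_iff:
  assumes "is_quiver Q"
  shows "quiver_matrix Q $ i $ j > 0 \<longleftrightarrow> Q j i > 0"
    and "quiver_matrix Q $ i $ j > 0 \<Longrightarrow> quiver_matrix Q $ i $ j = int (Q j i)"
    and "quiver_matrix Q $ i $ j = 0 \<longleftrightarrow> Q i j = 0 \<and> Q j i = 0"
proof -
  have "Q i j = 0 \<or> Q j i = 0"
    using assms by (auto simp: is_quiver_def)
  then show "quiver_matrix Q $ i $ j > 0 \<longleftrightarrow> Q j i > 0"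
    and "quiver_matrix Q $ i $ j > 0 \<Longrightarrow> quiver_matrix Q $ i $ j = int (Q j i)"
    and "quiver_matrix Q $ i $ j = 0 \<longleftrightarrow> Q i j = 0 \<and> Q j i = 0"
    by (auto simp: quiver_matrix_def)
qed

definition quiver_isomorphic :: "'m::finite quiver \<Rightarrow> 'n::finite quiver \<Rightarrow> bool" where
  "quiver_isomorphic Q Q' \<longleftrightarrow> (\<exists>\<sigma>. bij \<sigma> \<and> (\<forall>i j. Q i j = Q' (\<sigma> i) (\<sigma> j)))"

definition pos_part :: "int \<Rightarrow> int" where
  "pos_part b = max b 0"

definition matrix_mutation :: "'n::finite \<Rightarrow> int^'n^'n \<Rightarrow> int^'n^'n" where
  "matrix_mutation k B =
    (\<chi> i j. if i = k \<or> j = k then - B $ i $ j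
            else B $ i $ j + pos_part (B $ i $ k) * pos_part (B $ k $ j)
                           - pos_part (- B $ i $ k) * pos_part (- B $ k $ j))"

text \<open>
  Quivers are taken up to isomorphism, so the two vertex types may differ: some sequence of
  mutations of \<open>Q'\<close> yields \<open>Q\<close> after a relabelling \<open>\<sigma>\<close> of the vertices.
\<close>

definition mutation_equivalent :: "'m::finite quiver \<Rightarrow> 'n::finite quiver \<Rightarrow> bool" where
  "mutation_equivalent Q Q' \<longleftrightarrow>
    (\<exists>ks \<sigma>. bij \<sigma> \<and>
      (\<forall>i j. quiver_matrix Q $ i $ j =
             fold matrix_mutation ks (quiver_matrix Q') $ \<sigma> i $ \<sigma> j))"

type_synonym 'n y_seed = "('n \<Rightarrow> int^'n) \<times> (int^'n^'n)"

text \<open>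
  The order on vectors is componentwise, so \<open>0 < v\<close> says that \<open>v\<close> is non-zero with all
  entries non-negative, and \<open>v < 0\<close> that it is non-zero with all entries non-positive.
\<close>

lemma vec_pos_iff: "0 < (v :: int^'n::finite) \<longleftrightarrow> v \<noteq> 0 \<and> (\<forall>i. 0 \<le> v $ i)"
  by (auto simp: less_le less_eq_vec_def)

lemma vec_neg_iff: "(v :: int^'n::finite) < 0 \<longleftrightarrow> v \<noteq> 0 \<and> (\<forall>i. v $ i \<le> 0)"
  by (auto simp: less_le less_eq_vec_def)

text \<open>The value \<open>0\<close> on vectors without a sign is a dummy.\<close>

definition vec_sgn :: "int^'n::finite \<Rightarrow> int" where
  "vec_sgn v = (if 0 < v then 1 else if v < 0 then -1 else 0)"

text \<open>
  Mutation at \<open>k\<close> is meaningful only if the \<open>k\<close>-th vector has a sign; green sequences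
  mutate only at indices whose vector is positive.
\<close>

definition y_seed_mutation :: "'n::finite \<Rightarrow> 'n y_seed \<Rightarrow> 'n y_seed" where
  "y_seed_mutation k = (\<lambda>(c, B).
    ((\<lambda>i. if i = k then - c k
          else c i + pos_part (vec_sgn (c k) * B $ k $ i) *s c k),
     matrix_mutation k B))"

definition initial_y_seed :: "int^'n^'n \<Rightarrow> 'n::finite y_seed" where
  "initial_y_seed B = ((\<lambda>i. axis i 1), B)"

definition green_sequence :: "int^'n^'n \<Rightarrow> 'n::finite list \<Rightarrow> bool" where
  "green_sequence B ks \<longleftrightarrow>
    (\<forall>k < length ks. 0 < fst (fold y_seed_mutation (take k ks) (initial_y_seed B)) (ks ! k))"

definition maximal_green_sequence :: "int^'n^'n \<Rightarrow> 'n::finite list \<Rightarrow> bool" where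
  "maximal_green_sequence B ks \<longleftrightarrow>
    green_sequence B ks \<and>
    (\<forall>k. fst (fold y_seed_mutation ks (initial_y_seed B)) k < 0)"

datatype branch = I1 | I2 | I3

text \<open>\<open>V0\<close>, \<open>Va i\<close> and \<open>Vb i\<close> are the vertices $0$, $a_i$ and $b_i$.\<close>

datatype x7_vertex = V0 | Va branch | Vb branch

instance branch :: finite
proof
  have "(UNIV :: branch set) = {I1, I2, I3}"
    using branch.exhaust by blast
  moreover have "finite {I1, I2, I3}"
    by simp
  ultimately show "finite (UNIV :: branch set)"
    by metis
qed

instance x7_vertex :: finite
proof
  have "(UNIV :: x7_vertex set) = insert V0 (range Va \<union> range Vb)"
    using x7_vertex.exhaust by blast
  moreover have "finite (insert V0 (range Va \<union> range Vb))"
    by simp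
  ultimately show "finite (UNIV :: x7_vertex set)"
    by metis
qed

fun X7 :: "x7_vertex quiver" where
  "X7 V0 (Va i) = 1"
| "X7 (Va i) (Vb j) = (if i = j then 2 else 0)"
| "X7 (Vb i) V0 = 1"
| "X7 _ _ = 0"

fun X7' :: "x7_vertex quiver" where
  "X7' (Va i) V0 = 1"
| "X7' V0 (Vb i) = 1"
| "X7' (Va i) (Vb j) = (if i = j then 1 else 0)"
| "X7' (Vb i) (Va j) = (if i \<noteq> j then 1 else 0)"
| "X7' _ _ = 0"

lemma is_quiver_X7: "is_quiver X7"
proof -
  have "X7 i i = 0" "X7 i j = 0 \<or> X7 j i = 0" for i j
    by (cases i; cases j; simp)+
  then show ?thesis
    by (simp add: is_quiver_def)
qed

lemma is_quiver_X7': "is_quiver X7'"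
proof -
  have "X7' i i = 0" "X7' i j = 0 \<or> X7' j i = 0" for i j
    by (cases i; cases j; simp)+
  then show ?thesis
    by (simp add: is_quiver_def)
qed

end

theory Submission
  imports Defs
begin

text \<open>
  The radical of the matrix of \<open>X7\<close> is spanned by the vector with entry 2 at \<open>0\<close> and 1
  elsewhere, that of \<open>X7'\<close> by the all-ones vector. If \<open>m\<close> is a radical vector of \<open>B\<close>, then
  \<open>\<Sum>i. m i *s c i\<close> keeps its value along Y-seed mutations, provided the entry of \<open>m\<close> at the
  mutated vertex is replaced suitably; within the mutation class of \<open>X7\<close> this replacement turns
  the positive radical vectors above into each other. Hence a positive combination of the
  \<open>c i\<close> always equals a fixed positive vector, and the \<open>c i\<close> can never all be negative.
\<close>

section \<open>Weights under mutation and relabelling\<close>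

text \<open>Mutation at a positive \<open>c k\<close> adds \<open>pos_part (B $ k $ j)\<close>
  copies of \<open>c k\<close> to each other \<open>c j\<close> and negates \<open>c k\<close>. The
  new entry at \<open>k\<close> is what restores the total coefficient of \<open>c k\<close> in the
  weighted sum.\<close>

definition weight_mutation :: "'n::finite \<Rightarrow> int^'n^'n \<Rightarrow> ('n \<Rightarrow> int) \<Rightarrow> 'n \<Rightarrow> int" where
  "weight_mutation k B m = m(k := (\<Sum>j\<in>UNIV. pos_part (B $ k $ j) * m j) - m k)"

definition weighted_iso ::
    "int^'m^'m \<Rightarrow> ('m::finite \<Rightarrow> int) \<Rightarrow> int^'n^'n \<Rightarrow> ('n::finite \<Rightarrow> int) \<Rightarrow> ('m \<Rightarrow> 'n) \<Rightarrow> bool" where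
  "weighted_iso B m C w \<sigma> \<longleftrightarrow>
    bij \<sigma> \<and> (\<forall>i j. B $ i $ j = C $ \<sigma> i $ \<sigma> j) \<and> (\<forall>i. m i = w (\<sigma> i))"

lemma weighted_iso_trans:
  "weighted_iso B m C w \<sigma> \<Longrightarrow> weighted_iso C w D v \<tau> \<Longrightarrow> weighted_iso B m D v (\<tau> \<circ> \<sigma>)"
  by (auto simp: weighted_iso_def intro: bij_comp)

text \<open>Both mutation rules are natural under relabelling, so closure of the class needs
  checking only on the two models, at each of their seven vertices.\<close>

lemma weighted_iso_mutation:
  assumes "weighted_iso B m C w \<sigma>"
  shows "weighted_iso (matrix_mutation k B) (weight_mutation k B m)
    (matrix_mutation (\<sigma> k) C) (weight_mutation (\<sigma> k) C w) \<sigma>"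
proof -
  have \<sigma>: "bij \<sigma>" and B: "B $ i $ j = C $ \<sigma> i $ \<sigma> j" and m: "m i = w (\<sigma> i)" for i j
    using assms by (auto simp: weighted_iso_def)
  have eq: "\<sigma> i = \<sigma> j \<longleftrightarrow> i = j" for i j
    using \<sigma> by (meson bij_def injD)
  have "(\<Sum>j\<in>UNIV. pos_part (C $ \<sigma> k $ \<sigma> j) * w (\<sigma> j)) = (\<Sum>j\<in>UNIV. pos_part (C $ \<sigma> k $ j) * w j)"
    using \<sigma> by (rule sum.reindex_bij_betw)
  with \<sigma> show ?thesis
    by (simp add: weighted_iso_def matrix_mutation_def weight_mutation_def B m eq)
qed

section \<open>Single mutations of the two weighted models\<close>

fun radical_X7 :: "x7_vertex \<Rightarrow> int" where
  "radical_X7 V0 = 2"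
| "radical_X7 (Va i) = 1"
| "radical_X7 (Vb i) = 1"

definition X7_class :: "int^'n^'n \<Rightarrow> ('n::finite \<Rightarrow> int) \<Rightarrow> bool" where
  "X7_class B m \<longleftrightarrow> (\<exists>\<sigma>. weighted_iso B m (quiver_matrix X7) radical_X7 \<sigma> \<or>
    weighted_iso B m (quiver_matrix X7') (\<lambda>_. 1) \<sigma>)"

lemma X7_class_pos: "X7_class B m \<Longrightarrow> 0 < m i"
proof -
  have "0 < radical_X7 v" for v
    by (cases v) auto
  then show "X7_class B m \<Longrightarrow> 0 < m i"
    by (auto simp: X7_class_def weighted_iso_def)
qed

lemma X7_class_weighted_iso: "weighted_iso B m C w \<sigma> \<Longrightarrow> X7_class C w \<Longrightarrow> X7_class B m"
  unfolding X7_class_def by (meson weighted_iso_trans)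

lemma all_branch: "(\<forall>i. P i) \<longleftrightarrow> P I1 \<and> P I2 \<and> P I3"
  by (metis branch.exhaust)

lemma all_x7_vertex: "(\<forall>v. P v) \<longleftrightarrow> P V0 \<and> (\<forall>i. P (Va i)) \<and> (\<forall>i. P (Vb i))"
  by (metis x7_vertex.exhaust)

lemma sum_x7_vertex:
  "(\<Sum>v\<in>UNIV. f v) = f V0 + f (Va I1) + f (Va I2) + f (Va I3) + f (Vb I1) + f (Vb I2) + f (Vb I3)"
  for f :: "x7_vertex \<Rightarrow> int"
proof -
  have "(UNIV :: x7_vertex set) = {V0, Va I1, Va I2, Va I3, Vb I1, Vb I2, Vb I3}"
    by (auto intro: x7_vertex.exhaust simp: set_eq_iff all_x7_vertex all_branch)
  then have "sum f UNIV = sum f {V0, Va I1, Va I2, Va I3, Vb I1, Vb I2, Vb I3}"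
    by (rule arg_cong)
  also have "\<dots> = f V0 + f (Va I1) + f (Va I2) + f (Va I3) + f (Vb I1) + f (Vb I2) + f (Vb I3)"
    by simp
  finally show ?thesis .
qed

lemma bij_x7_vertexI: "(\<forall>u v. \<tau> u = \<tau> v \<longrightarrow> u = v) \<Longrightarrow> bij \<tau>" for \<tau> :: "x7_vertex \<Rightarrow> x7_vertex"
  by (simp add: bij_def finite_UNIV_inj_surj inj_def)

lemmas x7_compute = weighted_iso_def all_x7_vertex all_branch quiver_matrix_def
  matrix_mutation_def weight_mutation_def sum_x7_vertex pos_part_def

text \<open>Each path from \<open>Vb j\<close> through \<open>V0\<close> to \<open>Va i\<close>
  yields a new arrow; for \<open>i = j\<close> it cancels one of the two arrows back. The weight at
  \<open>V0\<close> becomes 3 - 2 = 1; in the reverse direction it is 3 - 1 = 2.\<close>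

lemma X7_mutation_V0:
  "weighted_iso (matrix_mutation V0 (quiver_matrix X7)) (weight_mutation V0 (quiver_matrix X7) radical_X7)
    (quiver_matrix X7') (\<lambda>_. 1) id"
  by (simp add: x7_compute)

lemma X7'_mutation_V0:
  "weighted_iso (matrix_mutation V0 (quiver_matrix X7')) (weight_mutation V0 (quiver_matrix X7') (\<lambda>_. 1))
    (quiver_matrix X7) radical_X7 id"
  by (simp add: x7_compute)

fun swap_branch :: "branch \<Rightarrow> x7_vertex \<Rightarrow> x7_vertex" where
  "swap_branch i V0 = V0"
| "swap_branch i (Va j) = (if j = i then Vb j else Va j)"
| "swap_branch i (Vb j) = (if j = i then Va j else Vb j)"

lemma bij_swap_branch: "bij (swap_branch i)"
  by (rule bij_x7_vertexI) (simp add: all_x7_vertex)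

text \<open>The two new arrows from \<open>V0\<close> to \<open>Vb i\<close> cancel and reverse the
  old one, so the triangle changes orientation, which swapping its outer vertices undoes. The weight
  stays 2 - 1 = 1.\<close>

lemma X7_mutation_Va:
  "weighted_iso (matrix_mutation (Va i) (quiver_matrix X7))
    (weight_mutation (Va i) (quiver_matrix X7) radical_X7) (quiver_matrix X7) radical_X7 (swap_branch i)"
  using bij_swap_branch[of i] by (cases i) (simp_all add: x7_compute)

lemma X7_mutation_Vb:
  "weighted_iso (matrix_mutation (Vb i) (quiver_matrix X7))
    (weight_mutation (Vb i) (quiver_matrix X7) radical_X7) (quiver_matrix X7) radical_X7 (swap_branch i)"
  using bij_swap_branch[of i] by (cases i) (simp_all add: x7_compute)

text \<open>The transposition of the branches other than \<open>i\<close>. After mutating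
  \<open>X7'\<close> at \<open>Va i\<close> or \<open>Vb i\<close>, the old arrow from
  \<open>Vb j\<close> to \<open>Va k\<close>, with \<open>i\<close>, \<open>j\<close>,
  \<open>k\<close> distinct, joins the two outer vertices of one new branch, so their indices must
  be matched.\<close>

definition reflect_branch :: "branch \<Rightarrow> branch \<Rightarrow> branch" where
  "reflect_branch i j = (if j = i then i else THE k. k \<noteq> i \<and> k \<noteq> j)"

lemma reflect_branch_simps [simp]:
  "reflect_branch i i = i"
  "reflect_branch I1 I2 = I3" "reflect_branch I1 I3 = I2"
  "reflect_branch I2 I1 = I3" "reflect_branch I2 I3 = I1"
  "reflect_branch I3 I1 = I2" "reflect_branch I3 I2 = I1"
  unfolding reflect_branch_def by (auto intro!: the_equality intro: branch.exhaust)

text \<open>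
  After mutating \<open>X7'\<close> at \<open>a\<^sub>i\<close> the only vertex of degree 6 is \<open>b\<^sub>i\<close>, and after mutating at
  \<open>b\<^sub>i\<close> it is \<open>a\<^sub>i\<close>; so these become the new vertex \<open>0\<close>.
\<close>

fun recentre_Vb :: "branch \<Rightarrow> x7_vertex \<Rightarrow> x7_vertex" where
  "recentre_Vb i V0 = Va i"
| "recentre_Vb i (Va j) = Vb (reflect_branch i j)"
| "recentre_Vb i (Vb j) = (if j = i then V0 else Va j)"

fun recentre_Va :: "branch \<Rightarrow> x7_vertex \<Rightarrow> x7_vertex" where
  "recentre_Va i V0 = Vb i"
| "recentre_Va i (Va j) = (if j = i then V0 else Vb j)"
| "recentre_Va i (Vb j) = Va (reflect_branch i j)"

lemma bij_recentre_Vb: "bij (recentre_Vb i)"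
  by (rule bij_x7_vertexI, cases i) (simp_all add: all_x7_vertex all_branch)

lemma bij_recentre_Va: "bij (recentre_Va i)"
  by (rule bij_x7_vertexI, cases i) (simp_all add: all_x7_vertex all_branch)

lemma X7'_mutation_Va:
  "weighted_iso (matrix_mutation (Va i) (quiver_matrix X7'))
    (weight_mutation (Va i) (quiver_matrix X7') (\<lambda>_. 1)) (quiver_matrix X7') (\<lambda>_. 1) (recentre_Vb i)"
  using bij_recentre_Vb[of i] by (cases i) (simp_all add: x7_compute)

lemma X7'_mutation_Vb:
  "weighted_iso (matrix_mutation (Vb i) (quiver_matrix X7'))
    (weight_mutation (Vb i) (quiver_matrix X7') (\<lambda>_. 1)) (quiver_matrix X7') (\<lambda>_. 1) (recentre_Va i)"
  using bij_recentre_Va[of i] by (cases i) (simp_all add: x7_compute)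

section \<open>The mutation class of \<open>X7\<close>\<close>

lemma X7_class_mutation:
  assumes "X7_class B m"
  shows "X7_class (matrix_mutation k B) (weight_mutation k B m)"
proof -
  have "X7_class (matrix_mutation v (quiver_matrix X7)) (weight_mutation v (quiver_matrix X7) radical_X7)" for v
    unfolding X7_class_def
    by (cases v) (use X7_mutation_V0 X7_mutation_Va X7_mutation_Vb in blast)+
  moreover
  have "X7_class (matrix_mutation v (quiver_matrix X7')) (weight_mutation v (quiver_matrix X7') (\<lambda>_. 1))" for v
    unfolding X7_class_def
    by (cases v) (use X7'_mutation_V0 X7'_mutation_Va X7'_mutation_Vb in blast)+
  ultimately show ?thesis
    \<comment> \<open>Only the hypothesis on \<open>B\<close> is opened; the goal stays folded and
      is pulled back from the mutated model.\<close>
    using assms unfolding X7_class_def[of B]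
    by (meson weighted_iso_mutation X7_class_weighted_iso)
qed

lemma X7_class_fold_mutation:
  "X7_class B m \<Longrightarrow> \<exists>m'. X7_class (fold matrix_mutation ks B) m'"
  by (induction ks arbitrary: B m) (auto intro: X7_class_mutation)

lemma X7_class_diagonal: "X7_class B m \<Longrightarrow> B $ i $ i = 0"
  by (auto simp: X7_class_def weighted_iso_def quiver_matrix_def)

text \<open>Without 2-cycles the difference of the two opposite multiplicities determines
  both.\<close>

lemma quiver_eqI_matrix:
  assumes "is_quiver Q" "is_quiver R" "\<And>i j. quiver_matrix Q $ i $ j = quiver_matrix R $ \<sigma> i $ \<sigma> j"
  shows "Q i j = R (\<sigma> i) (\<sigma> j)"
proof -
  have "Q i j = 0 \<or> Q j i = 0" "R (\<sigma> i) (\<sigma> j) = 0 \<or> R (\<sigma> j) (\<sigma> i) = 0"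
    using assms(1,2) by (auto simp: is_quiver_def)
  with assms(3)[of i j] show ?thesis
    by (auto simp: quiver_matrix_def)
qed

lemma mutation_equivalent_X7_class:
  assumes "mutation_equivalent Q X7"
  shows "\<exists>m. X7_class (quiver_matrix Q) m"
proof -
  obtain ks \<sigma> where \<sigma>: "bij \<sigma>"
    and Q: "quiver_matrix Q $ i $ j = fold matrix_mutation ks (quiver_matrix X7) $ \<sigma> i $ \<sigma> j" for i j
    using assms unfolding mutation_equivalent_def by blast
  have "weighted_iso (quiver_matrix X7) radical_X7 (quiver_matrix X7) radical_X7 id"
    by (simp add: weighted_iso_def)
  then have "X7_class (quiver_matrix X7) radical_X7"
    unfolding X7_class_def by blast
  then obtain w where w: "X7_class (fold matrix_mutation ks (quiver_matrix X7)) w"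
    using X7_class_fold_mutation by blast
  \<comment> \<open>The weight reached on the vertices of \<open>X7\<close> is pulled back to those
    of \<open>Q\<close>.\<close>
  have "weighted_iso (quiver_matrix Q) (w \<circ> \<sigma>) (fold matrix_mutation ks (quiver_matrix X7)) w \<sigma>"
    using \<sigma> Q by (simp add: weighted_iso_def)
  with w show ?thesis
    using X7_class_weighted_iso by blast
qed

lemma mutation_equivalent_X7_iff:
  assumes "is_quiver Q"
  shows "mutation_equivalent Q X7 \<longleftrightarrow> quiver_isomorphic Q X7 \<or> quiver_isomorphic Q X7'"
proof
  assume "mutation_equivalent Q X7"
  then obtain m \<sigma> where "weighted_iso (quiver_matrix Q) m (quiver_matrix X7) radical_X7 \<sigma> \<or>
      weighted_iso (quiver_matrix Q) m (quiver_matrix X7') (\<lambda>_. 1) \<sigma>"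
    using mutation_equivalent_X7_class unfolding X7_class_def by blast
  then show "quiver_isomorphic Q X7 \<or> quiver_isomorphic Q X7'"
    unfolding weighted_iso_def quiver_isomorphic_def
    using quiver_eqI_matrix[OF assms is_quiver_X7] quiver_eqI_matrix[OF assms is_quiver_X7'] by metis
next
  assume "quiver_isomorphic Q X7 \<or> quiver_isomorphic Q X7'"
  then show "mutation_equivalent Q X7"
  proof
    assume "quiver_isomorphic Q X7"
    then obtain \<sigma> where "bij \<sigma>" "\<forall>i j. Q i j = X7 (\<sigma> i) (\<sigma> j)"
      unfolding quiver_isomorphic_def by blast
    then show ?thesis
      unfolding mutation_equivalent_def
      by (intro exI[of _ "[]"] exI[of _ \<sigma>]) (simp add: quiver_matrix_def)
  next
    assume "quiver_isomorphic Q X7'"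
    then obtain \<sigma> where "bij \<sigma>" "\<forall>i j. Q i j = X7' (\<sigma> i) (\<sigma> j)"
      unfolding quiver_isomorphic_def by blast
    moreover have "matrix_mutation V0 (quiver_matrix X7) $ u $ v = quiver_matrix X7' $ u $ v" for u v
      using X7_mutation_V0 by (simp add: weighted_iso_def)
    ultimately show ?thesis
      unfolding mutation_equivalent_def
      \<comment> \<open>One mutation at \<open>V0\<close> turns \<open>X7\<close> into
        \<open>X7'\<close> with the same vertex names, so \<open>\<sigma>\<close> serves
        unchanged.\<close>
      by (intro exI[of _ "[V0]"] exI[of _ \<sigma>]) (simp add: quiver_matrix_def)
  qed
qed

section \<open>Weighted sums along green sequences\<close>

lemma snd_y_seed_mutation: "snd (y_seed_mutation k s) = matrix_mutation k (snd s)"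
  by (simp add: y_seed_mutation_def split_beta)

lemma weighted_sum_y_seed_mutation:
  assumes "0 < fst s k" "snd s $ k $ k = 0"
  shows "(\<Sum>i\<in>UNIV. weight_mutation k (snd s) m i *s fst (y_seed_mutation k s) i) =
    (\<Sum>i\<in>UNIV. m i *s fst s i)"
proof -
  obtain c B where s: "s = (c, B)"
    by force
  have pos: "vec_sgn (c k) = 1" and diag: "pos_part (B $ k $ k) = 0"
    using assms by (simp_all add: s vec_sgn_def pos_part_def)
  let ?p = "\<lambda>i. pos_part (B $ k $ i)"
  let ?M = "\<Sum>i\<in>UNIV. ?p i * m i"
  \<comment> \<open>At \<open>i = k\<close> the zero diagonal removes the middle term, and the
    correction \<open>?M *s c k\<close> comes from the new weight at \<open>k\<close>. Summed over
    all \<open>i\<close>, the middle terms cancel this correction.\<close>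
  have "(\<Sum>i\<in>UNIV. weight_mutation k B m i *s fst (y_seed_mutation k s) i) =
      (\<Sum>i\<in>UNIV. m i *s c i + (?p i * m i) *s c k - (if i = k then ?M *s c k else 0))"
    by (rule sum.cong)
      (auto simp: s weight_mutation_def y_seed_mutation_def pos diag vec_eq_iff algebra_simps)
  also have "\<dots> = (\<Sum>i\<in>UNIV. m i *s c i) + (\<Sum>i\<in>UNIV. (?p i * m i) *s c k) - ?M *s c k"
    by (simp add: sum.distrib sum_subtractf)
  also have "(\<Sum>i\<in>UNIV. (?p i * m i) *s c k) = ?M *s c k"
    by (simp add: vec_eq_iff sum_distrib_right)
  finally show ?thesis
    by (simp add: s)
qed

lemma green_sequence_snoc:
  "green_sequence B (ks @ [k]) \<longleftrightarrow>
    green_sequence B ks \<and> 0 < fst (fold y_seed_mutation ks (initial_y_seed B)) k"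
  unfolding green_sequence_def by (auto simp: less_Suc_eq nth_append)

text \<open>The weights change along the sequence while the sum keeps its initial value, which is
  \<open>m\<close> itself because the initial \<open>c\<close> is the standard basis.\<close>

lemma green_sequence_weighted_sum:
  assumes "X7_class B m" "green_sequence B ks"
  shows "\<exists>w. X7_class (snd (fold y_seed_mutation ks (initial_y_seed B))) w \<and>
    (\<Sum>i\<in>UNIV. w i *s fst (fold y_seed_mutation ks (initial_y_seed B)) i) = (\<chi> i. m i)"
  using assms(2)
proof (induction ks rule: rev_induct)
  case Nil
  have "(\<Sum>i\<in>UNIV. m i *s axis i 1) = (\<chi> i. m i)"
    by (simp add: vec_eq_iff axis_def if_distrib cong: if_cong)
  with assms(1) show ?case
    by (auto simp: initial_y_seed_def)
next
  case (snoc k ks)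
  let ?s = "fold y_seed_mutation ks (initial_y_seed B)"
  have pos: "0 < fst ?s k" and "green_sequence B ks"
    using snoc.prems by (auto simp: green_sequence_snoc)
  then obtain w where w: "X7_class (snd ?s) w" "(\<Sum>i\<in>UNIV. w i *s fst ?s i) = (\<chi> i. m i)"
    using snoc.IH by blast
  have "X7_class (snd (y_seed_mutation k ?s)) (weight_mutation k (snd ?s) w)"
    using w(1) by (simp add: snd_y_seed_mutation X7_class_mutation)
  moreover have "(\<Sum>i\<in>UNIV. weight_mutation k (snd ?s) w i *s fst (y_seed_mutation k ?s) i) = (\<chi> i. m i)"
    using weighted_sum_y_seed_mutation[OF pos X7_class_diagonal[OF w(1)]] w(2) by simp
  ultimately show ?case
    by auto
qed

lemma X7_class_no_maximal_green_sequence: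
  assumes "X7_class B m"
  shows "\<not> maximal_green_sequence B ks"
proof
  let ?c = "fst (fold y_seed_mutation ks (initial_y_seed B))"
  assume "maximal_green_sequence B ks"
  then have green: "green_sequence B ks" and neg: "?c k < 0" for k
    by (auto simp: maximal_green_sequence_def)
  obtain w where w: "X7_class (snd (fold y_seed_mutation ks (initial_y_seed B))) w"
    and sum: "(\<Sum>i\<in>UNIV. w i *s ?c i) = (\<chi> i. m i)"
    using green_sequence_weighted_sum[OF assms green] by blast
  fix j
  \<comment> \<open>Any single coordinate gives the contradiction: the left side is positive, and
    the right side has positive weights on non-positive entries.\<close>
  have "m j = (\<Sum>i\<in>UNIV. w i * ?c i $ j)"
    using arg_cong[OF sum, of "\<lambda>v. v $ j"] by simp
  also have "\<dots> \<le> 0"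
    using X7_class_pos[OF w] neg
    by (intro sum_nonpos mult_nonneg_nonpos) (auto simp: vec_neg_iff less_imp_le)
  finally show False
    using X7_class_pos[OF assms, of j] by simp
qed

theorem theorem1:
  fixes Q :: "'n::finite quiver"
  assumes "is_quiver Q"
  shows "(mutation_equivalent Q X7 \<longleftrightarrow> quiver_isomorphic Q X7 \<or> quiver_isomorphic Q X7') \<and>
    (mutation_equivalent Q X7 \<longrightarrow>
      \<not> (\<exists>ks. maximal_green_sequence (quiver_matrix Q) ks))"
  using mutation_equivalent_X7_iff[OF assms] mutation_equivalent_X7_class
    X7_class_no_maximal_green_sequence by blast

end
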